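(* Let $d$ and $n>1$ be positive integers with $n\equiv d+1 \pmod{2d}$. Then \[ \sum_{k=0}^{(n-1)/d}[3dk+1]\frac{(q;q^{2d})_{k}(q^{d-1};q^{d})_{k}(q;q^{d})_{k}^2}{(q^{d};q^{d})_{k}(q^{d+2};q^{2d})_{k}(q^{2d};q^{2d})_{k}^2}q^{d(k^{2}+k)/2}\equiv 0 \pmod{\Phi_{n}(q)^2}. \]
   Context: For an indeterminate $q$, $(x;q)_k=(1-x)(1-xq)\cdots(1-xq^{k-1})$ (with $(x;q)_0=1$). $[m]=(1-q^m)/(1-q)$ is the $q$-integer and $\Phi_n(q)$ is the $n$-th cyclotomic polynomial. A congruence between rational functions in $q$ modulo a polynomial $P(q)$ means that the difference is $P(q)$ times a rational function whose denominator is coprime to $P(q)$.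
   Formalization: The formal theorem assumes d > 1: for d = 1 the factor (q^{d-1};q^d)_k = (1;q)_k vanishes for k ≥ 1, so the sum equals 1 and the congruence fails for every admissible n. *)

theory Defs
  imports
    "HOL-Analysis.Analysis"
    "HOL-Computational_Algebra.Computational_Algebra"
    "HOL-Number_Theory.Cong"
begin

definition cyclotomic :: "nat \<Rightarrow> complex poly" where
  "cyclotomic n =
     (\<Prod>k | k \<in> {1..n} \<and> coprime k n. [:- cis (2 * pi * real k / real n), 1:])"

definition q_pochhammer :: "'a::comm_ring_1 \<Rightarrow> 'a \<Rightarrow> nat \<Rightarrow> 'a" where
  "q_pochhammer x q k = (\<Prod>i<k. 1 - x * q ^ i)"

definition q_integer :: "'a::field \<Rightarrow> nat \<Rightarrow> 'a" where
  "q_integer q m = (1 - q ^ m) / (1 - q)"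

definition ratfun_q :: "complex poly fract" where
  "ratfun_q = to_fract [:0, 1:]"

text \<open>
  The conjunct \<open>b \<noteq> 0\<close> matters only for constant \<open>P\<close>; \<open>Fract a 0 = 0\<close> by convention.
\<close>

definition ratfun_cong ::
  "complex poly fract \<Rightarrow> complex poly fract \<Rightarrow> complex poly \<Rightarrow> bool" where
  "ratfun_cong A B P \<longleftrightarrow>
     (\<exists>a b. b \<noteq> 0 \<and> coprime b P \<and> A - B = to_fract P * Fract a b)"

lemma degree_cyclotomic_pos:
  assumes "n > 1"
  shows "degree (cyclotomic n) > 0"
proof -
  let ?A = "{k. k \<in> {1..n} \<and> coprime k n}"
  have fin: "finite ?A" by (rule finite_subset[of _ "{1..n}"]) auto
  have "degree (cyclotomic n) = (\<Sum>k\<in>?A. 1)"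
    unfolding cyclotomic_def by (subst degree_prod_eq_sum_degree) auto
  also have "\<dots> = card ?A" by simp
  also have "1 \<in> ?A" using assms by auto
  hence "card ?A > 0" using fin card_gt_0_iff by blast
  finally show ?thesis .
qed

text \<open>
  For \<open>d = 1\<close> the factor \<open>(q\<^sup>d\<^sup>-\<^sup>1; q\<^sup>d)\<^sub>k = (1; q)\<^sub>k\<close> vanishes for \<open>k \<ge> 1\<close>, so
  the sum is its \<open>k = 0\<close> term \<open>1\<close> and the congruence fails: the hypothesis
  \<open>d > 1\<close> cannot be dropped.
\<close>

lemma not_ratfun_cong_d_eq_1:
  fixes d n :: nat
  assumes d: "d = 1" and n: "n > 1"
  shows "\<not> ratfun_cong
    (\<Sum>k=0..(n - 1) div d.
       q_integer ratfun_q (3 * d * k + 1) *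
       (q_pochhammer ratfun_q (ratfun_q ^ (2 * d)) k *
        q_pochhammer (ratfun_q ^ (d - 1)) (ratfun_q ^ d) k *
        (q_pochhammer ratfun_q (ratfun_q ^ d) k)\<^sup>2 /
        (q_pochhammer (ratfun_q ^ d) (ratfun_q ^ d) k *
         q_pochhammer (ratfun_q ^ (d + 2)) (ratfun_q ^ (2 * d)) k *
         (q_pochhammer (ratfun_q ^ (2 * d)) (ratfun_q ^ (2 * d)) k)\<^sup>2)) *
       ratfun_q ^ (d * (k\<^sup>2 + k) div 2))
    0 ((cyclotomic n)\<^sup>2)"
    (is "\<not> ratfun_cong (\<Sum>k=0..?N. ?f k) 0 _")
proof
  assume cong: "ratfun_cong (\<Sum>k=0..?N. ?f k) 0 ((cyclotomic n)\<^sup>2)"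
  have q1: "ratfun_q \<noteq> 1"
    by (simp add: ratfun_q_def to_fract_def One_fract_def eq_fract one_pCons)
  have zero: "q_pochhammer 1 x k = 0" if "k > 0" for k and x :: "complex poly fract"
    using that unfolding q_pochhammer_def by (intro prod_zero) (auto intro!: bexI[of _ 0])
  have "?f k = 0" if "k > 0" for k
    using zero[OF that] d by simp
  hence "(\<Sum>k=0..?N. ?f k) = (\<Sum>k\<in>{0}. ?f k)"
    by (intro sum.mono_neutral_right) auto
  also have "\<dots> = 1"
    using q1 by (simp add: q_integer_def q_pochhammer_def)
  finally have sum: "(\<Sum>k=0..?N. ?f k) = 1" .
  obtain a b where b: "b \<noteq> 0" "coprime b ((cyclotomic n)\<^sup>2)"
    and eq: "1 = to_fract ((cyclotomic n)\<^sup>2) * Fract a b"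
    using cong unfolding ratfun_cong_def sum by auto
  have "b = (cyclotomic n)\<^sup>2 * a"
    using eq b(1) by (simp add: to_fract_def One_fract_def eq_fract)
  hence "(cyclotomic n)\<^sup>2 dvd b" by simp
  hence "is_unit ((cyclotomic n)\<^sup>2)"
    using b(2) by (meson coprime_common_divisor dvd_refl)
  hence "is_unit (cyclotomic n)" by (simp add: is_unit_power_iff)
  hence "degree (cyclotomic n) = 0"
    by (metis is_unit_iff_degree not_is_unit_0)
  thus False using degree_cyclotomic_pos[OF n] by simp
qed

end

theory Submission
  imports Defs "HOL-Computational_Algebra.Field_as_Ring"
begin

text \<open>
  Write \<open>p = q\<^sup>d\<close> and \<open>m = (n - 1) / d\<close>, which is odd. Up to the factor \<open>1 / (1 - q)\<close>, the sum is the case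
  \<open>a = b = q\<close> of a limiting case of the Gasper--Rahman quadratic summation, with terms
  \<open>(1 - a p\<^sup>3\<^sup>k) (a, b, c; p)\<^sub>k (a; p\<^sup>2)\<^sub>k p\<^bsup>k(k+1)/2\<^esup> / ((p\<^sup>2, abp, acp; p\<^sup>2)\<^sub>k (p; p)\<^sub>k)\<close> where \<open>b c = p\<close>.
  Telescoping contiguous relations under \<open>a \<mapsto> a p\<^sup>2\<close> and \<open>b \<mapsto> b p\<^sup>2\<close> show that the sum over \<open>k \<le> m\<close> vanishes
  when \<open>a = p\<^sup>-\<^sup>m\<close> and when \<open>b = p\<^sup>-\<^sup>m\<close>.
  Deform the sum to \<open>a = t q\<close>, \<open>b = q / t\<close>. After clearing denominators it is a polynomial in \<open>t\<close> whose
  coefficients are regular at \<open>\<Phi>\<^sub>n\<close>, and it vanishes at \<open>t = q\<^sup>n\<close> and \<open>t = q\<^sup>-\<^sup>n\<close>, because \<open>q\<^sup>1\<^sup>-\<^sup>n = p\<^sup>-\<^sup>m\<close>.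
  So its value at \<open>t = 1\<close> is divisible by \<open>(1 - q\<^sup>n) (1 - q\<^sup>-\<^sup>n)\<close>, hence by \<open>\<Phi>\<^sub>n\<^sup>2\<close>.
\<close>

section \<open>A terminating quadratic summation\<close>

lemma q_pochhammer_0 [simp]: "q_pochhammer x q 0 = 1"
  by (simp add: q_pochhammer_def)

lemma q_pochhammer_Suc: "q_pochhammer x q (Suc k) = q_pochhammer x q k * (1 - x * q ^ k)"
  by (simp add: q_pochhammer_def)

lemma q_pochhammer_eq_0:
  assumes "x * q ^ i = 1" "i < k"
  shows "q_pochhammer x q k = 0"
  using assms unfolding q_pochhammer_def by (intro prod_zero) auto

lemma q_pochhammer_nonzero:
  fixes x q :: "'a::field"
  assumes "\<And>i. i < k \<Longrightarrow> x * q ^ i \<noteq> 1"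
  shows "q_pochhammer x q k \<noteq> 0"
  using assms unfolding q_pochhammer_def by auto

text \<open>Both sides are \<open>q_pochhammer x q (Suc k)\<close>, with the first factor split off
  on the left and the last one on the right.\<close>

lemma q_pochhammer_shift:
  "q_pochhammer (x * q) q k * (1 - x) = q_pochhammer x q k * (1 - x * q ^ k)"
proof (induction k)
  case (Suc k)
  have "q_pochhammer (x * q) q (Suc k) * (1 - x) =
      (q_pochhammer (x * q) q k * (1 - x)) * (1 - x * q * q ^ k)"
    by (simp add: q_pochhammer_Suc mult_ac)
  thus ?case
    unfolding Suc.IH by (simp add: q_pochhammer_Suc mult_ac)
qed simp

lemma q_pochhammer_shift_div:
  fixes x q :: "'a::field"
  assumes "x \<noteq> 1"
  shows "q_pochhammer (x * q) q k = q_pochhammer x q k * ((1 - x * q ^ k) / (1 - x))"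
  using q_pochhammer_shift[of x q k] assms by (simp add: field_simps)

lemma q_pochhammer_shift2_div:
  fixes x q :: "'a::field"
  assumes "x \<noteq> 1" "x * q \<noteq> 1"
  shows "q_pochhammer (x * q\<^sup>2) q k =
    q_pochhammer x q k * ((1 - x * q ^ k) * (1 - x * q * q ^ k) / ((1 - x) * (1 - x * q)))"
  using q_pochhammer_shift_div[OF assms(1), of q k] q_pochhammer_shift_div[OF assms(2)]
  by (simp add: power2_eq_square mult.assoc)

section \<open>The quadratic summand, its parameter shifts and their telescoping\<close>

definition quad_base :: "'a::field \<Rightarrow> 'a \<Rightarrow> 'a \<Rightarrow> 'a \<Rightarrow> nat \<Rightarrow> 'a" where
  "quad_base p a b c k =
     q_pochhammer a p k * q_pochhammer b p k * q_pochhammer c p k * q_pochhammer a (p\<^sup>2) k *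
     p ^ (k * (k + 1) div 2) /
     (q_pochhammer (p\<^sup>2) (p\<^sup>2) k * q_pochhammer (a * b * p) (p\<^sup>2) k *
      q_pochhammer (a * c * p) (p\<^sup>2) k * q_pochhammer p p k)"

text \<open>\<open>quad_base\<close> omits the cubic factor because the telescoped sums are
  multiples of \<open>quad_base\<close> that do not contain it. The relation between
  \<open>b\<close> and \<open>c\<close> stays a hypothesis of the lemmas, since the recursion in
  \<open>b\<close> shifts one of them at a time.\<close>

definition quad_term :: "'a::field \<Rightarrow> 'a \<Rightarrow> 'a \<Rightarrow> 'a \<Rightarrow> nat \<Rightarrow> 'a" where
  "quad_term p a b c k = (1 - a * p ^ (3 * k)) * quad_base p a b c k"

lemma quad_base_0 [simp]: "quad_base p a b c 0 = 1"
  by (simp add: quad_base_def)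

lemma quad_base_Suc:
  "quad_base p a b c (Suc k) = quad_base p a b c k *
     ((1 - a * p ^ k) * (1 - b * p ^ k) * (1 - c * p ^ k) * (1 - a * (p ^ k)\<^sup>2) * (p * p ^ k) /
      ((1 - p\<^sup>2 * (p ^ k)\<^sup>2) * (1 - a * b * p * (p ^ k)\<^sup>2) * (1 - a * c * p * (p ^ k)\<^sup>2) *
       (1 - p * p ^ k)))"
proof -
  have "Suc k * (Suc k + 1) div 2 = k * (k + 1) div 2 + Suc k"
    by simp
  moreover have "(p\<^sup>2) ^ k = (p ^ k)\<^sup>2"
    by (simp add: power_even_eq flip: power_mult)
  ultimately show ?thesis
    by (simp add: quad_base_def q_pochhammer_Suc power_add mult_ac del: mult_Suc mult_Suc_right)
qed

text \<open>The base-\<open>p\<close> symbol of \<open>a\<close> moves by two steps and each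
  base-\<open>p\<^sup>2\<close> symbol containing \<open>a\<close> by one, so only factors at the
  ends of the products change.\<close>

lemma quad_base_shift_a:
  fixes p a b c :: "'a::field"
  assumes "a \<noteq> 1" "a * p \<noteq> 1" "a * b * p \<noteq> 1" "a * c * p \<noteq> 1"
  assumes "a * b * p * (p ^ k)\<^sup>2 \<noteq> 1" "a * c * p * (p ^ k)\<^sup>2 \<noteq> 1"
  shows "quad_base p (a * p\<^sup>2) b c k = quad_base p a b c k *
     ((1 - a * p ^ k) * (1 - a * p * p ^ k) * (1 - a * (p ^ k)\<^sup>2) * (1 - a * b * p) * (1 - a * c * p) /
      ((1 - a)\<^sup>2 * (1 - a * p) * (1 - a * b * p * (p ^ k)\<^sup>2) * (1 - a * c * p * (p ^ k)\<^sup>2)))"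
proof -
  have e: "(p\<^sup>2) ^ k = (p ^ k)\<^sup>2"
    by (simp add: power_even_eq flip: power_mult)
  have r: "a * p\<^sup>2 * b * p = a * b * p * p\<^sup>2" "a * p\<^sup>2 * c * p = a * c * p * p\<^sup>2"
    by simp_all
  show ?thesis
    unfolding quad_base_def r q_pochhammer_shift_div[OF assms(1), of "p\<^sup>2"]
      q_pochhammer_shift2_div[OF assms(1,2)]
      q_pochhammer_shift_div[OF assms(3), of "p\<^sup>2"] q_pochhammer_shift_div[OF assms(4), of "p\<^sup>2"] e
    using assms by (simp add: power2_eq_square mult_ac)
qed

text \<open>Both parameter pairs have product \<open>b * c * p\<^sup>2\<close>. If
  \<open>b * c * p = 1\<close>, this is \<open>p\<close>, so both belong to sums of the kind
  considered here.\<close>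

lemma quad_base_shift_b:
  fixes p a b c :: "'a::field"
  assumes "b \<noteq> 1" "b * p \<noteq> 1" "c \<noteq> 1" "c * p \<noteq> 1" "a * b * p \<noteq> 1" "a * c * p \<noteq> 1"
  assumes "c * p ^ k \<noteq> 1" "c * p * p ^ k \<noteq> 1"
  assumes "a * b * p * (p ^ k)\<^sup>2 \<noteq> 1" "a * c * p * (p ^ k)\<^sup>2 \<noteq> 1"
  shows "quad_base p a (b * p\<^sup>2) c k = quad_base p a b (c * p\<^sup>2) k *
     ((1 - b * p ^ k) * (1 - b * p * p ^ k) * (1 - c) * (1 - c * p) *
      (1 - a * c * p * (p ^ k)\<^sup>2) * (1 - a * b * p) /
      ((1 - b) * (1 - b * p) * (1 - c * p ^ k) * (1 - c * p * p ^ k) *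
       (1 - a * c * p) * (1 - a * b * p * (p ^ k)\<^sup>2)))"
proof -
  have e: "(p\<^sup>2) ^ k = (p ^ k)\<^sup>2"
    by (simp add: power_even_eq flip: power_mult)
  have r: "a * (b * p\<^sup>2) * p = a * b * p * p\<^sup>2" "a * (c * p\<^sup>2) * p = a * c * p * p\<^sup>2"
    by simp_all
  show ?thesis
    unfolding quad_base_def r
      q_pochhammer_shift2_div[OF assms(1,2)] q_pochhammer_shift2_div[OF assms(3,4)]
      q_pochhammer_shift_div[OF assms(5), of "p\<^sup>2"] q_pochhammer_shift_div[OF assms(6), of "p\<^sup>2"] e
    using assms by (simp add: power2_eq_square mult_ac)
qed

text \<open>One telescoping step for the shift of \<open>a\<close>, cleared of denominators, with
  \<open>x\<close> for the power of \<open>p\<close>. The left side is the difference of the two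
  summands, the right side the increment of the certificate.\<close>

lemma telescope_identity_a:
  fixes a b c p x :: "'a::field"
  assumes "b * c = p"
  shows "(1 - a * p\<^sup>2 * x ^ 3) * (1 - a * x) * (1 - a * p * x) * (1 - a * x\<^sup>2)
     - (1 - a) * (1 - a * x ^ 3) * ((1 - a * b * p * x\<^sup>2) * (1 - a * c * p * x\<^sup>2))
   = - a * ((1 - a * x) * (1 - b * x) * (1 - c * x) * (1 - a * x\<^sup>2) * (p * x)
     - (1 - x) * (1 - x\<^sup>2) * ((1 - a * b * p * x\<^sup>2) * (1 - a * c * p * x\<^sup>2)))"
  unfolding assms[symmetric] by algebra

text \<open>The corresponding step for exchanging the pair \<open>b * p\<^sup>2\<close>,
  \<open>c\<close> for the pair \<open>b\<close>, \<open>c * p\<^sup>2\<close>.\<close>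

lemma telescope_identity_b:
  fixes a b c p x :: "'a::field"
  assumes "b * c * p = 1"
  shows "(1 - a * x ^ 3) * ((1 - b) * (1 - c * x) * (1 - c * p * x) * (1 - a * b * p * x\<^sup>2)
     - (1 - c) * (1 - b * x) * (1 - b * p * x) * (1 - a * c * p * x\<^sup>2))
   = (b - c) * ((1 - a * x) * (1 - b * x) * (1 - a * x\<^sup>2) * (p * x) * (1 - c * x)
     - (1 - x) * (1 - x\<^sup>2) * ((1 - a * b * p * x\<^sup>2) * (1 - a * c * p * x\<^sup>2)))"
  using assms by algebra

text \<open>
  The right-hand sides below were found by \<open>q\<close>-Gosper summation of the contiguous relations.
\<close>

lemma quad_term_telescope_a:
  fixes p a b c :: "'a::field"
  assumes bc: "b * c = p" and a: "a \<noteq> 1" "a * p \<noteq> 1"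
  assumes p: "\<And>i. p * p ^ i \<noteq> 1" "\<And>i. p\<^sup>2 * (p ^ i)\<^sup>2 \<noteq> 1"
  assumes ab: "\<And>i. a * b * p * (p ^ i)\<^sup>2 \<noteq> 1" "\<And>i. a * c * p * (p ^ i)\<^sup>2 \<noteq> 1"
  shows "(\<Sum>k<m. (1 - a) * (1 - a * p) * quad_term p (a * p\<^sup>2) b c k
            - (1 - a * b * p) * (1 - a * c * p) * quad_term p a b c k)
       = (1 - a * b * p) * (1 - a * c * p) * (- a / (1 - a)) *
         (1 - p ^ m) * (1 - (p ^ m)\<^sup>2) * quad_base p a b c m"
proof (induction m)
  case (Suc m)
  define x where "x = p ^ m"
  define U where "U = quad_base p a b c m"
  define D where "D = (1 - a * b * p * x\<^sup>2) * (1 - a * c * p * x\<^sup>2)"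
  define C where "C = (1 - a * b * p) * (1 - a * c * p)"
  define E where "E = (1 - a * p\<^sup>2 * x ^ 3) * (1 - a * x) * (1 - a * p * x) * (1 - a * x\<^sup>2)"
  define H where "H = (1 - a * x) * (1 - b * x) * (1 - c * x) * (1 - a * x\<^sup>2) * (p * x)"
  have ab0: "a * b * p \<noteq> 1" "a * c * p \<noteq> 1"
    using ab[of 0] by simp_all
  have nz: "D \<noteq> 0" "1 - a \<noteq> 0"
    using ab[of m] a by (simp_all add: D_def x_def)
  have x3: "p ^ (3 * m) = x ^ 3"
    by (simp add: x_def mult.commute flip: power_mult)
  have 1: "(1 - a) * (1 - a * p) * quad_term p (a * p\<^sup>2) b c m = C * U * E / ((1 - a) * D)"
    unfolding quad_term_def quad_base_shift_a[OF a ab0 ab] x3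
    using a by (simp add: x_def[symmetric] U_def[symmetric] C_def D_def E_def power2_eq_square mult_ac)
  have 2: "(1 - a * b * p) * (1 - a * c * p) * quad_term p a b c m = C * U * (1 - a * x ^ 3)"
    by (simp add: quad_term_def x3 U_def C_def)
  have "quad_base p a b c (Suc m) = U * H / ((1 - (p * x)\<^sup>2) * (1 - p * x) * D)"
    by (simp add: quad_base_Suc U_def D_def H_def x_def power_mult_distrib mult_ac)
  \<comment> \<open>These two factors of the certificate cancel the denominators that
    \<open>(p; p)\<close> and \<open>(p\<^sup>2; p\<^sup>2)\<close> contribute to the term ratio.
    They also make the certificate vanish at \<open>m = 0\<close>.\<close>
  hence "(1 - p ^ Suc m) * (1 - (p ^ Suc m)\<^sup>2) * quad_base p a b c (Suc m) = U * H / D"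
    using p[of m] by (simp add: x_def power_mult_distrib)
  hence 3: "(1 - a * b * p) * (1 - a * c * p) * (- a / (1 - a)) *
      (1 - p ^ Suc m) * (1 - (p ^ Suc m)\<^sup>2) * quad_base p a b c (Suc m)
      = C * (- a / (1 - a)) * (U * H / D)"
    by (simp add: C_def mult.assoc)
  have "E - (1 - a) * (1 - a * x ^ 3) * D = - a * (H - (1 - x) * (1 - x\<^sup>2) * D)"
    unfolding D_def E_def H_def by (rule telescope_identity_a[OF bc])
  hence "C * U * (E - (1 - a) * (1 - a * x ^ 3) * D) / ((1 - a) * D) = 
      C * U * (- a * (H - (1 - x) * (1 - x\<^sup>2) * D)) / ((1 - a) * D)"
    by simp
  hence "C * (- a / (1 - a)) * (1 - x) * (1 - x\<^sup>2) * U +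
     (C * U * E / ((1 - a) * D) - C * U * (1 - a * x ^ 3)) = C * (- a / (1 - a)) * (U * H / D)"
    using nz by (simp add: divide_simps) (simp add: algebra_simps)
  thus ?case
    unfolding sum.lessThan_Suc Suc.IH 1 2 3
    unfolding C_def[symmetric] U_def[symmetric] x_def[symmetric] .
qed simp

lemma quad_term_telescope_b:
  fixes p a b c :: "'a::field"
  assumes bc: "b * c * p = 1" and b: "b \<noteq> 1" "b * p \<noteq> 1"
  assumes c: "\<And>i. c * p ^ i \<noteq> 1"
  assumes p: "\<And>i. p * p ^ i \<noteq> 1" "\<And>i. p\<^sup>2 * (p ^ i)\<^sup>2 \<noteq> 1"
  assumes ab: "\<And>i. a * b * p * (p ^ i)\<^sup>2 \<noteq> 1" "\<And>i. a * c * p * (p ^ i)\<^sup>2 \<noteq> 1"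
  shows "(\<Sum>k<m. (1 - b * p) * (1 - a * c * p) * quad_term p a (b * p\<^sup>2) c k
            - (1 - c * p) * (1 - a * b * p) * quad_term p a b (c * p\<^sup>2) k)
       = (1 - a * b * p) * (b - c) / b * (1 - p ^ m) * (1 - (p ^ m)\<^sup>2) *
         (1 - a * c * p * (p ^ m)\<^sup>2) / ((1 - c * p ^ m) * (1 - c * p * p ^ m)) *
         quad_base p a b (c * p\<^sup>2) m"
proof (induction m)
  case (Suc m)
  define x where "x = p ^ m"
  define U where "U = quad_base p a b (c * p\<^sup>2) m"
  define B where "B = 1 - a * b * p * x\<^sup>2"
  define B' where "B' = 1 - a * c * p * x\<^sup>2"
  define C where "C = 1 - c * x"
  define C' where "C' = 1 - c * p * x"
  define A where "A = 1 - a * x ^ 3"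
  define E where "E = (1 - c) * (1 - b * x) * (1 - b * p * x)"
  define H where "H = (1 - a * x) * (1 - b * x) * (1 - a * x\<^sup>2) * (p * x)"
  define K where "K = 1 - a * b * p"
  have b0: "b \<noteq> 0"
    using bc by auto
  have ab0: "a * b * p \<noteq> 1" "a * c * p \<noteq> 1"
    using ab[of 0] by simp_all
  have c0: "c \<noteq> 1" "c * p \<noteq> 1" "c * p * p ^ i \<noteq> 1" for i
    using c[of 0] c[of 1] c[of "Suc i"] by (simp_all add: mult.assoc)
  have nz: "B \<noteq> 0" "B' \<noteq> 0" "C \<noteq> 0" "C' \<noteq> 0" "1 - b \<noteq> 0"
    using ab[of m] c[of m] c0(3)[of m] b by (simp_all add: B_def B'_def C_def C'_def x_def)
  have x3: "p ^ (3 * m) = x ^ 3"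
    by (simp add: x_def mult.commute flip: power_mult)
  \<comment> \<open>\<open>c * p\<close> is the inverse of \<open>b\<close>. Rewriting
    \<open>1 - c * p\<close> this way cancels \<open>1 - b\<close> in the first summand and leaves
    \<open>b\<close> as a common denominator.\<close>
  have cp: "1 - c * p = - (1 - b) / b"
    using bc b0 by (simp add: field_simps)
  have "(1 - b * p) * (1 - a * c * p) * quad_term p a (b * p\<^sup>2) c m
      = A * U * (E * (1 - c * p) * B' * K / ((1 - b) * C * C' * B))"
    unfolding quad_term_def quad_base_shift_b[OF b c0(1,2) ab0 c c0(3) ab] x3
    using b ab0 by (simp add: x_def[symmetric] U_def[symmetric] A_def B_def B'_def C_def C'_def E_def K_def mult_ac)
  also have "\<dots> = - (K * U * A * E * B' / (b * C * C' * B))"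
    unfolding cp using nz b0 by (simp add: divide_simps) (simp add: algebra_simps)
  finally have 1: "(1 - b * p) * (1 - a * c * p) * quad_term p a (b * p\<^sup>2) c m = \<dots>" .
  have 2: "(1 - c * p) * (1 - a * b * p) * quad_term p a b (c * p\<^sup>2) m
      = - ((1 - b) * K * U * A / b)"
    unfolding cp quad_term_def x3 U_def[symmetric] K_def[symmetric] A_def[symmetric]
    using b0 by (simp add: field_simps)
  have "quad_base p a b (c * p\<^sup>2) (Suc m) = U * H * (1 - c * p * (p * x)) /
     ((1 - (p * x)\<^sup>2) * (1 - p * x) * B * (1 - a * c * p * (p * x)\<^sup>2))"
    by (simp add: quad_base_Suc U_def B_def H_def x_def power2_eq_square mult_ac)
  \<comment> \<open>All factors of the certificate that depend on \<open>m\<close> cancel against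
    the term ratio, except \<open>1 - c * p ^ Suc m\<close>, which is \<open>C'\<close>.\<close>
  hence 3: "K * (b - c) / b * (1 - p ^ Suc m) * (1 - (p ^ Suc m)\<^sup>2) *
         (1 - a * c * p * (p ^ Suc m)\<^sup>2) / ((1 - c * p ^ Suc m) * (1 - c * p * p ^ Suc m)) *
         quad_base p a b (c * p\<^sup>2) (Suc m) = K * (b - c) / b * (U * H / (C' * B))"
    using p[of m] ab[of "Suc m"] c0(3)[of "Suc m"]
    by (simp add: x_def C'_def power_mult_distrib mult.assoc)
  have 4: "A * ((1 - b) * C * C' * B - E * B') = (b - c) * (H * C - (1 - x) * (1 - x\<^sup>2) * (B * B'))"
    unfolding A_def B_def B'_def C_def C'_def E_def H_def by (rule telescope_identity_b[OF bc])
  have "- (K * U * A * E * B' / (b * C * C' * B)) - - ((1 - b) * K * U * A / b) =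
      K * U * (A * ((1 - b) * C * C' * B - E * B')) / (b * C * C' * B)"
    using nz b0 by (simp add: divide_simps) (simp add: algebra_simps)
  also have "K * (b - c) / b * (1 - x) * (1 - x\<^sup>2) * B' / (C * C') * U + \<dots> =
      K * (b - c) / b * (U * H / (C' * B))"
    unfolding 4 using nz b0 by (simp add: divide_simps) (simp add: algebra_simps)
  finally have "K * (b - c) / b * (1 - x) * (1 - x\<^sup>2) * B' / (C * C') * U +
     (- (K * U * A * E * B' / (b * C * C' * B)) - - ((1 - b) * K * U * A / b)) =
     K * (b - c) / b * (U * H / (C' * B))" .
  thus ?case
    unfolding sum.lessThan_Suc Suc.IH 1 2 3[unfolded K_def]
    unfolding K_def[symmetric] U_def[symmetric] x_def[symmetric]
      B'_def[symmetric] C_def[symmetric] C'_def[symmetric] .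
qed simp

section \<open>Vanishing of the terminating sums\<close>

lemma quad_term_eq_0:
  assumes "a * p ^ i = 1 \<or> b * p ^ i = 1" "i < k"
  shows "quad_base p a b c k = 0" "quad_term p a b c k = 0"
  using assms q_pochhammer_eq_0[of _ p i k] by (auto simp: quad_term_def quad_base_def)

text \<open>Replacing \<open>b\<close> by \<open>b * p\<^sup>2\<close> lowers the odd exponent by
  two, and telescoping makes the two sums proportional. The last hypothesis keeps
  \<open>(a * b * p; p\<^sup>2)\<close> and \<open>(a * c * p; p\<^sup>2)\<close> away from
  zero.\<close>

lemma quad_sum_eq_0_b:
  fixes p a b c :: "'a::field"
  assumes p0: "p \<noteq> 0" and p: "\<And>i. i > 0 \<Longrightarrow> p ^ i \<noteq> 1"
  assumes "b * c = p" "b * p ^ (2 * j + 1) = 1"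
  assumes "\<And>i. a * p ^ Suc i \<noteq> p ^ (2 * j + 1)"
  shows "(\<Sum>k<2 * j + 2. quad_term p a b c k) = 0"
  using assms(3-5)
proof (induction j arbitrary: b c)
  case 0
  have bp: "b * p = 1" and bc: "b * c = p" and a: "\<And>i. a * p ^ Suc i \<noteq> p"
    using 0 by simp_all
  have "c * (b * p) = b * c * p"
    by (simp add: mult_ac)
  hence c: "c = p * p"
    unfolding bp bc by simp
  have a1: "a \<noteq> 1" "a * p ^ 3 \<noteq> 1"
    using a[of 0] a[of 3] p0 by (auto simp: eval_nat_numeral mult_ac)
  have p1: "p \<noteq> 1" "p\<^sup>2 \<noteq> 1"
    using p[of 1] p[of 2] by simp_all
  have e: "a * b * p = a" "a * c * p = a * p ^ 3" "c = p\<^sup>2" "b = 1 / p"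
    using bp c p0 by (simp_all add: eval_nat_numeral field_simps)
  \<comment> \<open>With \<open>b = 1 / p\<close> only the terms at \<open>0\<close> and
    \<open>1\<close> remain, and they are \<open>1 - a\<close> and its negative.\<close>
  have "quad_base p a b c 1 = (1 - a) * (1 - b) * (1 - p\<^sup>2) * (1 - a) * p /
      ((1 - p\<^sup>2) * (1 - a) * (1 - a * p ^ 3) * (1 - p))"
    using e by (simp add: quad_base_def q_pochhammer_def)
  also have "\<dots> = - ((1 - a) / (1 - a * p ^ 3))"
    unfolding e(4) using p0 p1 a1 by (simp add: divide_simps) (simp add: algebra_simps)
  finally have "quad_term p a b c 1 = - (1 - a)"
    using a1 by (simp add: quad_term_def)
  thus ?case
    by (simp add: numeral_2_eq_2) (simp add: quad_term_def)
next
  case (Suc j)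
  define m where "m = 2 * j + 3"
  \<comment> \<open>The value forced by \<open>b * c' * p = 1\<close>. Then
    \<open>c = c' * p\<^sup>2\<close>, so the goal is one side of the telescoping relation and the
    induction hypothesis treats the other.\<close>
  define c' where "c' = p ^ (2 * j + 2)"
  have bm: "b * p ^ m = 1" and a: "\<And>i. a * p ^ Suc i \<noteq> p ^ m"
    using Suc.prems by (simp_all add: m_def eval_nat_numeral)
  have bc': "b * c' * p = 1"
    using bm by (simp add: m_def c'_def eval_nat_numeral mult_ac)
  have "c = b * c' * p * c"
    using bc' by simp
  also have "\<dots> = c' * p\<^sup>2"
    using Suc.prems(1) by (simp add: power2_eq_square mult_ac)
  finally have c: "c = c' * p\<^sup>2" .
  have b1: "b \<noteq> 1"
    using bm p[of m] by (auto simp: m_def)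
  have b2: "b * p \<noteq> 1"
  proof
    assume "b * p = 1"
    moreover have "b * p * p ^ (2 * j + 2) = 1"
      using bm by (simp add: m_def eval_nat_numeral mult_ac)
    ultimately show False
      using p[of "2 * j + 2"] by simp
  qed
  have c1: "c' * p ^ i \<noteq> 1" for i
    using p[of "2 * j + 2 + i"] by (simp add: c'_def power_add mult_ac)
  have p1: "p * p ^ i \<noteq> 1" "p\<^sup>2 * (p ^ i)\<^sup>2 \<noteq> 1" for i
    using p[of "Suc i"] p[of "2 * Suc i"]
    by (simp_all add: power_mult_distrib power_even_eq del: mult_Suc_right)
  have a1: "a * b * p * (p ^ i)\<^sup>2 \<noteq> 1" for i
  proof
    assume "a * b * p * (p ^ i)\<^sup>2 = 1"
    hence "a * b * p * (p ^ i)\<^sup>2 * p ^ m = p ^ m"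
      by simp
    hence "a * p ^ Suc (2 * i) * (b * p ^ m) = p ^ m"
      by (simp add: mult_ac flip: power_mult)
    thus False
      using bm a[of "2 * i"] by simp
  qed
  have a2: "a * c' * p * (p ^ i)\<^sup>2 \<noteq> 1" for i
  proof
    assume "a * c' * p * (p ^ i)\<^sup>2 = 1"
    hence "a * c' * p * (p ^ i)\<^sup>2 * p ^ m = p ^ m"
      by simp
    hence "a * p ^ Suc (2 * j + 2 + 2 * i + m) = p ^ m"
      by (simp add: c'_def power_add mult_ac flip: power_mult)
    thus False
      using a by blast
  qed
  have IH: "(\<Sum>k<2 * j + 2. quad_term p a (b * p\<^sup>2) c' k) = 0"
  proof (rule Suc.IH)
    show "b * p\<^sup>2 * c' = p"
      using bc' by (metis mult.assoc mult.commute mult_1 power2_eq_square)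
    show "b * p\<^sup>2 * p ^ (2 * j + 1) = 1"
      using bm by (simp add: m_def eval_nat_numeral mult_ac)
    show "a * p ^ Suc i \<noteq> p ^ (2 * j + 1)" for i
    proof
      assume "a * p ^ Suc i = p ^ (2 * j + 1)"
      hence "a * p ^ Suc i * p\<^sup>2 = p ^ (2 * j + 1) * p\<^sup>2"
        by simp
      hence "a * p ^ Suc (i + 2) = p ^ m"
        by (simp add: m_def eval_nat_numeral mult_ac)
      thus False
        using a by blast
    qed
  qed
  have b'm: "b * p\<^sup>2 * p ^ (2 * j + 1) = 1"
    using bm by (simp add: m_def eval_nat_numeral mult_ac)
  \<comment> \<open>The shifted sum terminates two terms earlier, so extending its range adds only
    zeros.\<close>
  have "(\<Sum>k<m + 1. quad_term p a (b * p\<^sup>2) c' k) = (\<Sum>k<2 * j + 2. quad_term p a (b * p\<^sup>2) c' k)"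
    using b'm by (intro sum.mono_neutral_right) (auto simp: m_def intro!: quad_term_eq_0(2)[of _ _ "2 * j + 1"])
  hence "(\<Sum>k<m + 1. quad_term p a (b * p\<^sup>2) c' k) = 0"
    using IH by simp
  \<comment> \<open>The boundary term vanishes: \<open>quad_base\<close> at \<open>m + 1\<close>
    contains the factor \<open>1 - b * p ^ m\<close>.\<close>
  hence "- ((1 - c' * p) * (1 - a * b * p) * (\<Sum>k<m + 1. quad_term p a b (c' * p\<^sup>2) k)) = 0"
    using quad_term_telescope_b[OF bc' b1 b2 c1 p1 a1 a2, of "m + 1"]
      quad_term_eq_0(1)[of a p m b "m + 1" "c' * p\<^sup>2"] bm
    by (simp add: sum_subtractf flip: sum_distrib_left del: sum.lessThan_Suc)
  moreover have "c' * p \<noteq> 1" "a * b * p \<noteq> 1"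
    using c1[of 1] a1[of 0] by simp_all
  ultimately have "(\<Sum>k<m + 1. quad_term p a b (c' * p\<^sup>2) k) = 0"
    by (simp del: sum.lessThan_Suc)
  thus ?case
    by (simp add: c m_def eval_nat_numeral)
qed

text \<open>The same descent with \<open>a\<close> replaced by \<open>a * p\<^sup>2\<close> and
  \<open>b\<close>, \<open>c\<close> fixed. The first inequality keeps
  \<open>(a * c * p; p\<^sup>2)\<close> away from zero, the second
  \<open>(a * b * p; p\<^sup>2)\<close>.\<close>

lemma quad_sum_eq_0_a:
  fixes p a b c :: "'a::field"
  assumes p0: "p \<noteq> 0" and p: "\<And>i. i > 0 \<Longrightarrow> p ^ i \<noteq> 1" and bc: "b * c = p"
  assumes "a * p ^ (2 * j + 1) = 1"
  assumes "\<And>i. b * p ^ (2 * j + 1) \<noteq> p ^ (2 * (i + 1))"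
  assumes "\<And>i. b * p ^ (2 * i + 1) \<noteq> p ^ (2 * j + 1)"
  shows "(\<Sum>k<2 * j + 2. quad_term p a b c k) = 0"
  using assms(4-6)
proof (induction j arbitrary: a)
  case 0
  have ap: "a * p = 1" and b: "b \<noteq> 1" "b \<noteq> p"
    using 0(1) 0(2)[of 0] 0(3)[of 0] by (auto simp: power2_eq_square)
  have c: "c \<noteq> 1"
    using bc b by auto
  have p1: "p \<noteq> 1" "p\<^sup>2 \<noteq> 1"
    using p[of 1] p[of 2] by simp_all
  have e: "a * b * p = b" "a * c * p = c" "a * p ^ 3 = p\<^sup>2" "a = 1 / p"
    using ap p0 by (simp_all add: eval_nat_numeral field_simps)
  \<comment> \<open>With \<open>a = 1 / p\<close> the factors \<open>1 - b\<close> and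
    \<open>1 - c\<close> cancel, and again the two terms are opposite.\<close>
  have "quad_base p a b c 1 = (1 - a) * (1 - b) * (1 - c) * (1 - a) * p /
      ((1 - p\<^sup>2) * (1 - b) * (1 - c) * (1 - p))"
    using e by (simp add: quad_base_def q_pochhammer_def)
  also have "\<dots> = - ((1 - a) / (1 - p\<^sup>2))"
    unfolding e(4) using p0 p1 b c by (simp add: divide_simps) (simp add: algebra_simps)
  finally have "quad_term p a b c 1 = - (1 - a)"
    using e(3) p1 by (simp add: quad_term_def)
  thus ?case
    by (simp add: numeral_2_eq_2) (simp add: quad_term_def)
next
  case (Suc j)
  define m where "m = 2 * j + 3"
  have am: "a * p ^ m = 1"
    and b1: "\<And>i. b * p ^ m \<noteq> p ^ (2 * (i + 1))" and b2: "\<And>i. b * p ^ (2 * i + 1) \<noteq> p ^ m"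
    using Suc.prems by (simp_all add: m_def eval_nat_numeral)
  have b0: "b \<noteq> 0"
    using bc p0 by auto
  have a1: "a \<noteq> 1"
    using am p[of m] by (auto simp: m_def)
  have a2: "a * p \<noteq> 1"
  proof
    assume "a * p = 1"
    moreover have "a * p * p ^ (2 * j + 2) = 1"
      using am by (simp add: m_def eval_nat_numeral mult_ac)
    ultimately show False
      using p[of "2 * j + 2"] by simp
  qed
  have p1: "p * p ^ i \<noteq> 1" "p\<^sup>2 * (p ^ i)\<^sup>2 \<noteq> 1" for i
    using p[of "Suc i"] p[of "2 * Suc i"]
    by (simp_all add: power_mult_distrib power_even_eq del: mult_Suc_right)
  have ab1: "a * b * p * (p ^ i)\<^sup>2 \<noteq> 1" for i
  proof
    assume "a * b * p * (p ^ i)\<^sup>2 = 1"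
    hence "a * b * p * (p ^ i)\<^sup>2 * p ^ m = p ^ m"
      by simp
    hence "b * p ^ (2 * i + 1) * (a * p ^ m) = p ^ m"
      by (simp add: mult_ac flip: power_mult)
    thus False
      using am b2[of i] by simp
  qed
  have ab2: "a * c * p * (p ^ i)\<^sup>2 \<noteq> 1" for i
  proof
    assume "a * c * p * (p ^ i)\<^sup>2 = 1"
    \<comment> \<open>Multiplication by \<open>b * p ^ m\<close> eliminates \<open>a\<close> and
      \<open>c\<close> through \<open>a * p ^ m = 1\<close> and \<open>b * c = p\<close>.\<close>
    hence "a * c * p * (p ^ i)\<^sup>2 * (b * p ^ m) = b * p ^ m"
      by simp
    hence "(b * c) * p * (p ^ i)\<^sup>2 * (a * p ^ m) = b * p ^ m"
      by (simp add: mult_ac)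
    hence "b * p ^ m = p ^ (2 * (i + 1))"
      unfolding am bc by (simp add: mult_ac flip: power_mult)
    thus False
      using b1 by blast
  qed
  have a'm: "a * p\<^sup>2 * p ^ (2 * j + 1) = 1"
    using am by (simp add: m_def eval_nat_numeral mult_ac)
  have IH: "(\<Sum>k<2 * j + 2. quad_term p (a * p\<^sup>2) b c k) = 0"
  proof (rule Suc.IH[OF a'm])
    show "b * p ^ (2 * j + 1) \<noteq> p ^ (2 * (i + 1))" for i
    proof
      assume "b * p ^ (2 * j + 1) = p ^ (2 * (i + 1))"
      hence "b * p ^ (2 * j + 1) * p\<^sup>2 = p ^ (2 * (i + 1)) * p\<^sup>2"
        by simp
      hence "b * p ^ m = p ^ (2 * (Suc i + 1))"
        by (simp add: m_def eval_nat_numeral mult_ac)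
      thus False
        using b1 by blast
    qed
    show "b * p ^ (2 * i + 1) \<noteq> p ^ (2 * j + 1)" for i
    proof
      assume "b * p ^ (2 * i + 1) = p ^ (2 * j + 1)"
      hence "b * p ^ (2 * i + 1) * p\<^sup>2 = p ^ (2 * j + 1) * p\<^sup>2"
        by simp
      hence "b * p ^ (2 * Suc i + 1) = p ^ m"
        by (simp add: m_def eval_nat_numeral mult_ac)
      thus False
        using b2 by blast
    qed
  qed
  have "(\<Sum>k<m + 1. quad_term p (a * p\<^sup>2) b c k) = (\<Sum>k<2 * j + 2. quad_term p (a * p\<^sup>2) b c k)"
    using a'm by (intro sum.mono_neutral_right) (auto simp: m_def intro!: quad_term_eq_0(2)[of _ _ "2 * j + 1"])
  hence "(\<Sum>k<m + 1. quad_term p (a * p\<^sup>2) b c k) = 0"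
    using IH by simp
  hence "- ((1 - a * b * p) * (1 - a * c * p) * (\<Sum>k<m + 1. quad_term p a b c k)) = 0"
    using quad_term_telescope_a[OF bc a1 a2 p1 ab1 ab2, of "m + 1"]
      quad_term_eq_0(1)[of a p m b "m + 1" c] am
    by (simp add: sum_subtractf flip: sum_distrib_left del: sum.lessThan_Suc)
  moreover have "a * b * p \<noteq> 1" "a * c * p \<noteq> 1"
    using ab1[of 0] ab2[of 0] by simp_all
  ultimately have "(\<Sum>k<m + 1. quad_term p a b c k) = 0"
    by (simp del: sum.lessThan_Suc)
  thus ?case
    by (simp add: m_def eval_nat_numeral)
qed

section \<open>Polynomials over a subring of a field\<close>

text \<open>The subring is a set inside the field, so that polynomials with coefficients in it can
  be handled with root arguments over the field.\<close>

locale field_subring =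
  fixes R :: "'a::field set"
  assumes one_closed [simp, intro]: "1 \<in> R"
    and diff_closed [simp, intro]: "x \<in> R \<Longrightarrow> y \<in> R \<Longrightarrow> x - y \<in> R"
    and mult_closed [simp, intro]: "x \<in> R \<Longrightarrow> y \<in> R \<Longrightarrow> x * y \<in> R"
begin

lemma zero_closed [simp, intro]: "0 \<in> R"
  using diff_closed[of 1 1] by simp

lemma uminus_closed [simp, intro]: "x \<in> R \<Longrightarrow> - x \<in> R"
  using diff_closed[of 0 x] by simp

lemma add_closed [simp, intro]: "x \<in> R \<Longrightarrow> y \<in> R \<Longrightarrow> x + y \<in> R"
  using diff_closed[of x "- y"] by simp

lemma power_closed [simp, intro]: "x \<in> R \<Longrightarrow> x ^ k \<in> R"
  by (induction k) auto

lemma sum_closed: "(\<And>i. i \<in> A \<Longrightarrow> f i \<in> R) \<Longrightarrow> sum f A \<in> R"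
  by (induction A rule: infinite_finite_induct) auto

lemma prod_closed: "(\<And>i. i \<in> A \<Longrightarrow> f i \<in> R) \<Longrightarrow> prod f A \<in> R"
  by (induction A rule: infinite_finite_induct) auto

definition polys :: "'a poly set" where
  "polys = {P. \<forall>i. coeff P i \<in> R}"

lemma pCons_polys [simp]: "pCons a P \<in> polys \<longleftrightarrow> a \<in> R \<and> P \<in> polys"
  unfolding polys_def by (force simp: coeff_pCons split: nat.splits)

lemma zero_polys [simp]: "0 \<in> polys"
  by (simp add: polys_def)

lemma one_polys [simp]: "1 \<in> polys"
  by (simp add: one_pCons)

lemma diff_polys: "P \<in> polys \<Longrightarrow> Q \<in> polys \<Longrightarrow> P - Q \<in> polys"
  by (simp add: polys_def)

lemma mult_polys: "P \<in> polys \<Longrightarrow> Q \<in> polys \<Longrightarrow> P * Q \<in> polys"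
  by (auto simp: polys_def coeff_mult intro!: sum_closed)

lemma smult_polys: "a \<in> R \<Longrightarrow> P \<in> polys \<Longrightarrow> smult a P \<in> polys"
  by (simp add: polys_def)

lemma power_polys: "P \<in> polys \<Longrightarrow> P ^ k \<in> polys"
  by (induction k) (auto intro: mult_polys)

lemma sum_polys: "(\<And>i. i \<in> A \<Longrightarrow> f i \<in> polys) \<Longrightarrow> sum f A \<in> polys"
  by (induction A rule: infinite_finite_induct) (auto simp: polys_def)

lemma prod_polys: "(\<And>i. i \<in> A \<Longrightarrow> f i \<in> polys) \<Longrightarrow> prod f A \<in> polys"
  by (induction A rule: infinite_finite_induct) (auto intro: mult_polys)

lemma q_pochhammer_polys: "x \<in> polys \<Longrightarrow> y \<in> polys \<Longrightarrow> q_pochhammer x y k \<in> polys"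
  unfolding q_pochhammer_def by (intro prod_polys diff_polys mult_polys power_polys) auto

lemma poly_closed: "P \<in> polys \<Longrightarrow> x \<in> R \<Longrightarrow> poly P x \<in> R"
  by (induction P) auto

lemma synthetic_div_polys: "P \<in> polys \<Longrightarrow> x \<in> R \<Longrightarrow> synthetic_div P x \<in> polys"
  by (induction P) (auto intro: poly_closed)

text \<open>Dividing by a monic linear factor keeps the coefficients in \<open>R\<close>. The roots
  are split off one after the other, so \<open>u - v\<close> only has to be nonzero and may be a
  non-unit of \<open>R\<close>; in the application it is divisible by the cyclotomic
  polynomial.\<close>

lemma polys_two_roots:
  assumes "P \<in> polys" "u \<in> R" "v \<in> R" "u \<noteq> v" "poly P u = 0" "poly P v = 0" "x \<in> R"
  shows "\<exists>r\<in>R. poly P x = (x - u) * (x - v) * r"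
proof -
  define Q where "Q = synthetic_div P u"
  have P: "P = [:- u, 1:] * Q"
    using synthetic_div_correct'[of u P] assms(5) by (simp add: Q_def)
  hence "poly Q v = 0"
    using assms(4,6) by simp
  hence Q: "Q = [:- v, 1:] * synthetic_div Q v"
    using synthetic_div_correct'[of v Q] by simp
  have "poly Q x = (x - v) * poly (synthetic_div Q v) x"
    by (subst Q) (simp add: algebra_simps)
  hence "poly P x = (x - u) * (x - v) * poly (synthetic_div Q v) x"
    by (subst P) (simp add: left_diff_distrib mult.assoc)
  moreover have "poly (synthetic_div Q v) x \<in> R"
    using assms unfolding Q_def by (intro poly_closed synthetic_div_polys) auto
  ultimately show ?thesis
    by blast
qed

end

section \<open>The deformed sum as a polynomial in \<open>t\<close>\<close>

lemma poly_q_pochhammer: "poly (q_pochhammer x y k) z = q_pochhammer (poly x z) (poly y z) k"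
  by (simp add: q_pochhammer_def poly_prod)

text \<open>
  \<open>t\<^sup>m (t\<^sup>2 p\<^sup>2; p\<^sup>2)\<^sub>m\<close> times the \<open>k\<close>-th term with \<open>(a, b, c) = (t q, q / t, t r)\<close>, as a polynomial
  in \<open>t\<close>.
\<close>

definition quad_poly :: "'a::field \<Rightarrow> 'a \<Rightarrow> 'a \<Rightarrow> nat \<Rightarrow> nat \<Rightarrow> 'a poly" where
  "quad_poly p q r m k =
     smult (p ^ (k * (k + 1) div 2) /
         (q_pochhammer (p\<^sup>2) (p\<^sup>2) k * q_pochhammer (q\<^sup>2 * p) (p\<^sup>2) k * q_pochhammer p p k))
       ([:1, - (q * p ^ (3 * k)):] * q_pochhammer [:0, q:] [:p:] k *
        ([:0, 1:] ^ (m - k) * (\<Prod>i<k. [:- (q * p ^ i), 1:])) *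
        q_pochhammer [:0, r:] [:p:] k * q_pochhammer [:0, q:] [:p\<^sup>2:] k *
        (\<Prod>i\<in>{k..<m}. [:1, 0, - (p\<^sup>2 * (p\<^sup>2) ^ i):]))"

lemma poly_quad_poly:
  assumes "q * r = p" "t \<noteq> 0" "k \<le> m" and nz: "q_pochhammer (t\<^sup>2 * p\<^sup>2) (p\<^sup>2) m \<noteq> 0"
  shows "poly (quad_poly p q r m k) t =
    t ^ m * q_pochhammer (t\<^sup>2 * p\<^sup>2) (p\<^sup>2) m * quad_term p (t * q) (q / t) (t * r) k"
proof -
  \<comment> \<open>\<open>t ^ k\<close> clears the denominators of \<open>(q / t; p)_k\<close>; the
    remaining \<open>t ^ (m - k)\<close> makes the clearing factor the same for every
    \<open>k\<close>.\<close>
  have 1: "(\<Prod>i<k. t - q * p ^ i) = t ^ k * q_pochhammer (q / t) p k"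
  proof -
    have "(\<Prod>i<k. t - q * p ^ i) = (\<Prod>i<k. t * (1 - q / t * p ^ i))"
      using \<open>t \<noteq> 0\<close> by (intro prod.cong) (auto simp: field_simps)
    thus ?thesis
      by (simp add: prod.distrib q_pochhammer_def)
  qed
  have split: "{..<m} = {..<k} \<union> {k..<m}"
    using \<open>k \<le> m\<close> by auto
  have 2: "q_pochhammer (t\<^sup>2 * p\<^sup>2) (p\<^sup>2) m =
      q_pochhammer (t\<^sup>2 * p\<^sup>2) (p\<^sup>2) k * (\<Prod>i\<in>{k..<m}. 1 - t\<^sup>2 * p\<^sup>2 * (p\<^sup>2) ^ i)"
    unfolding q_pochhammer_def split by (rule prod.union_disjoint) auto
  \<comment> \<open>In \<open>a * b * p\<close> the variable \<open>t\<close> cancels, so among the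
    Pochhammer symbols in the denominator only the one of \<open>a * c * p\<close> depends on
    \<open>t\<close>.\<close>
  have 3: "t * q * (q / t) * p = q\<^sup>2 * p" "t * q * (t * r) * p = t\<^sup>2 * p\<^sup>2"
    using \<open>t \<noteq> 0\<close> by (simp_all add: power2_eq_square mult_ac flip: assms(1))
  have 4: "t ^ (m - k) * t ^ k = t ^ m"
    using \<open>k \<le> m\<close> by (simp flip: power_add)
  have nz': "q_pochhammer (t\<^sup>2 * p\<^sup>2) (p\<^sup>2) k \<noteq> 0"
    using nz 2 by auto
  define X where "X = (\<Prod>i\<in>{k..<m}. 1 - t\<^sup>2 * p\<^sup>2 * (p\<^sup>2) ^ i)"
  have 5: "(\<Prod>i\<in>{k..<m}. poly [:1, 0, - (p\<^sup>2 * (p\<^sup>2) ^ i):] t) = X"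
    unfolding X_def by (intro prod.cong) (auto simp: power2_eq_square algebra_simps)
  have 6: "(\<Prod>i<k. poly [:- (q * p ^ i), 1:] t) = t ^ k * q_pochhammer (q / t) p k"
    unfolding 1[symmetric] by (intro prod.cong) auto
  have "poly (quad_poly p q r m k) t =
     p ^ (k * (k + 1) div 2) /
         (q_pochhammer (p\<^sup>2) (p\<^sup>2) k * q_pochhammer (q\<^sup>2 * p) (p\<^sup>2) k * q_pochhammer p p k) *
     ((1 - t * q * p ^ (3 * k)) * q_pochhammer (t * q) p k *
      (t ^ (m - k) * (t ^ k * q_pochhammer (q / t) p k)) *
      q_pochhammer (t * r) p k * q_pochhammer (t * q) (p\<^sup>2) k * X)"
    unfolding quad_poly_def poly_smult poly_mult poly_prod poly_power poly_q_pochhammer 5 6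
    by (simp add: mult_ac)
  also have "\<dots> = t ^ m * (q_pochhammer (t\<^sup>2 * p\<^sup>2) (p\<^sup>2) k * X) * quad_term p (t * q) (q / t) (t * r) k"
    unfolding quad_term_def quad_base_def 3 4[symmetric] using nz' by (simp add: mult_ac)
  finally show ?thesis
    unfolding 2 X_def .
qed

context field_subring
begin

lemma quad_poly_polys:
  assumes "p \<in> R" "q \<in> R" "r \<in> R"
  assumes "1 / (q_pochhammer (p\<^sup>2) (p\<^sup>2) k * q_pochhammer (q\<^sup>2 * p) (p\<^sup>2) k * q_pochhammer p p k) \<in> R"
  shows "quad_poly p q r m k \<in> polys"
proof -
  have "p ^ (k * (k + 1) div 2) * (1 /
      (q_pochhammer (p\<^sup>2) (p\<^sup>2) k * q_pochhammer (q\<^sup>2 * p) (p\<^sup>2) k * q_pochhammer p p k)) \<in> R"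
    using assms by (intro mult_closed power_closed)
  thus ?thesis
    unfolding quad_poly_def using assms
    by (intro smult_polys mult_polys power_polys prod_polys q_pochhammer_polys) auto
qed

text \<open>The original sum is the value at \<open>t = 1\<close>. The inverses required by
  \<open>den\<close> are the denominators free of \<open>t\<close>; the nonvanishing conditions turn
  the zeros of the deformed sum into roots of the polynomial and give its value at
  \<open>1\<close>.\<close>

lemma quad_sum_factor:
  assumes R: "p \<in> R" "q \<in> R" "r \<in> R" "u \<in> R" "v \<in> R" and qr: "q * r = p"
  assumes den: "\<And>k. k \<le> m \<Longrightarrow>
    1 / (q_pochhammer (p\<^sup>2) (p\<^sup>2) k * q_pochhammer (q\<^sup>2 * p) (p\<^sup>2) k * q_pochhammer p p k) \<in> R"
  assumes nz: "u \<noteq> 0" "v \<noteq> 0" "u \<noteq> v" "q_pochhammer (p\<^sup>2) (p\<^sup>2) m \<noteq> 0"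
    "q_pochhammer (u\<^sup>2 * p\<^sup>2) (p\<^sup>2) m \<noteq> 0" "q_pochhammer (v\<^sup>2 * p\<^sup>2) (p\<^sup>2) m \<noteq> 0"
  assumes roots: "(\<Sum>k\<le>m. quad_term p (u * q) (q / u) (u * r) k) = 0"
    "(\<Sum>k\<le>m. quad_term p (v * q) (q / v) (v * r) k) = 0"
  shows "\<exists>y\<in>R. q_pochhammer (p\<^sup>2) (p\<^sup>2) m * (\<Sum>k\<le>m. quad_term p q q r k) = (1 - u) * (1 - v) * y"
proof -
  define P where "P = (\<Sum>k\<le>m. quad_poly p q r m k)"
  have P: "poly P t = t ^ m * q_pochhammer (t\<^sup>2 * p\<^sup>2) (p\<^sup>2) m *
      (\<Sum>k\<le>m. quad_term p (t * q) (q / t) (t * r) k)"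
    if "t \<noteq> 0" "q_pochhammer (t\<^sup>2 * p\<^sup>2) (p\<^sup>2) m \<noteq> 0" for t
    unfolding P_def poly_sum sum_distrib_left
    by (intro sum.cong refl poly_quad_poly[OF qr that(1) _ that(2)]) auto
  have "P \<in> polys"
    unfolding P_def using R den by (intro sum_polys quad_poly_polys) auto
  moreover have "poly P u = 0" "poly P v = 0"
    using P[of u] P[of v] nz roots by simp_all
  ultimately have "\<exists>y\<in>R. poly P 1 = (1 - u) * (1 - v) * y"
    using R nz by (intro polys_two_roots) auto
  thus ?thesis
    using P[of 1] nz by simp
qed

end

section \<open>Localization at a cyclotomic polynomial\<close>

text \<open>The cofactors that \<open>ratfun_cong\<close> admits. Coprimality to \<open>P\<close>
  and to \<open>P\<^sup>2\<close> are the same condition, so this set also serves for the squared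
  modulus.\<close>

definition fract_localization :: "'a::{ring_gcd, idom} \<Rightarrow> 'a fract set" where
  "fract_localization P = {Fract a b | a b. b \<noteq> 0 \<and> coprime b P}"

interpretation localization: field_subring "fract_localization P"
  for P :: "'a::{ring_gcd, idom}"
proof
  show "1 \<in> fract_localization P"
    unfolding fract_localization_def One_fract_def by fastforce
next
  fix x y assume "x \<in> fract_localization P" "y \<in> fract_localization P"
  then obtain a b c d where "x = Fract a b" "y = Fract c d" "b \<noteq> 0" "coprime b P" "d \<noteq> 0" "coprime d P"
    unfolding fract_localization_def by auto
  hence "x - y = Fract (a * d - c * b) (b * d)" "x * y = Fract (a * c) (b * d)"
    "b * d \<noteq> 0" "coprime (b * d) P"
    by simp_all
  thus "x - y \<in> fract_localization P" "x * y \<in> fract_localization P"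
    unfolding fract_localization_def by blast+
qed

lemma to_fract_in_localization: "to_fract a \<in> fract_localization P"
  unfolding fract_localization_def to_fract_def by fastforce

lemma inverse_to_fract_in_localization:
  "b \<noteq> 0 \<Longrightarrow> coprime b P \<Longrightarrow> inverse (to_fract b) \<in> fract_localization P"
  unfolding fract_localization_def to_fract_def by auto

section \<open>Roots and divisibility of cyclotomic polynomials\<close>

lemma coprime_linear_poly:
  fixes f :: "complex poly"
  assumes "poly f c \<noteq> 0"
  shows "coprime f [:- c, 1:]"
proof -
  have "prime_elem [:- c, 1:]"
    by (rule prime_elem_linear_field_poly) simp
  moreover have "\<not> [:- c, 1:] dvd f"
    using assms by (simp add: poly_eq_0_iff_dvd)
  ultimately show ?thesis
    by (metis coprime_commute prime_elem_imp_coprime)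
qed

lemma cis_eq_root_of_unity:
  "cis (2 * pi * real k / real n) = exp (2 * of_real pi * \<i> * of_nat k / of_nat n)"
  by (simp add: cis_conv_exp mult_ac)

lemma cis_root_power_eq_1_iff:
  assumes "n > 0"
  shows "cis (2 * pi * real k / real n) ^ m = 1 \<longleftrightarrow> n dvd k * m"
proof -
  have "cis (2 * pi * real k / real n) ^ m = cis (2 * pi * real (k * m) / real n)"
    by (simp add: Complex.DeMoivre mult_ac)
  thus ?thesis
    using complex_root_unity_eq_1[of n "k * m"] assms by (simp only: cis_eq_root_of_unity)
qed

text \<open>Over the complex numbers coprimality can be tested root by root, and the
  \<open>m\<close>-th power of a primitive \<open>n\<close>-th root of unity is \<open>1\<close>
  only if \<open>n\<close> divides \<open>m\<close>.\<close>

lemma coprime_cyclotomic: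
  assumes "n > 0" "\<not> n dvd m"
  shows "coprime (1 - [:0, 1:] ^ m) (cyclotomic n)"
  unfolding cyclotomic_def
proof (rule prod_coprime_right, rule coprime_linear_poly)
  fix k assume "k \<in> {k. k \<in> {1..n} \<and> coprime k n}"
  hence "\<not> n dvd k * m"
    using assms by (simp add: coprime_commute coprime_dvd_mult_right_iff)
  thus "poly (1 - [:0, 1:] ^ m) (cis (2 * pi * real k / real n)) \<noteq> 0"
    using cis_root_power_eq_1_iff[OF assms(1), of k m] by auto
qed

lemma coprime_X_cyclotomic: "coprime [:0, 1:] (cyclotomic n)"
  unfolding cyclotomic_def by (intro prod_coprime_right coprime_linear_poly) simp

text \<open>The linear factors each divide \<open>1 - [:0, 1:] ^ n\<close> and are pairwise coprime,
  so their product divides it as well.\<close>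

lemma cyclotomic_dvd:
  assumes "n > 1"
  shows "cyclotomic n dvd 1 - [:0, 1:] ^ n"
proof -
  define z where "z k = cis (2 * pi * real k / real n)" for k
  \<comment> \<open>Below \<open>n\<close>, different indices give different roots. The index
    \<open>n\<close> itself is excluded because it is not coprime to \<open>n > 1\<close>.\<close>
  have less: "k < n" if "k \<in> {1..n}" "coprime k n" for k
    using that assms by (cases "k = n") auto
  have "(\<Prod>k\<in>A. [:- z k, 1:]) dvd 1 - [:0, 1:] ^ n" if "finite A" "A \<subseteq> {..<n}" for A
    using that
  proof (induction A rule: finite_induct)
    case (insert k A)
    have "z l \<noteq> z k" if "l \<in> A" for l
      using that insert complex_root_unity_eq[of n k l] assms
      by (auto simp: z_def cis_eq_root_of_unity)
    hence "coprime [:- z k, 1:] (\<Prod>l\<in>A. [:- z l, 1:])"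
      by (intro prod_coprime_right coprime_linear_poly) auto
    moreover have "[:- z k, 1:] dvd 1 - [:0, 1:] ^ n"
      using cis_root_power_eq_1_iff[of n k n] assms by (simp add: z_def flip: poly_eq_0_iff_dvd)
    ultimately show ?case
      unfolding prod.insert[OF insert.hyps] using insert by (intro divides_mult) auto
  qed simp
  moreover have "{k. k \<in> {1..n} \<and> coprime k n} \<subseteq> {..<n}"
    using less by auto
  ultimately show ?thesis
    unfolding cyclotomic_def z_def[symmetric] by (meson finite_lessThan finite_subset)
qed

section \<open>Powers of the indeterminate and units of the localization\<close>

lemma ratfun_q_power: "ratfun_q ^ m = to_fract ([:0, 1:] ^ m)"
  by (induction m) (simp_all only: power_0 power_Suc to_fract_1 to_fract_mult ratfun_q_def)

text \<open>Powers of the indeterminate differ in degree. This reduces the nonvanishing conditions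
  of the main proof to comparing exponents.\<close>

lemma ratfun_q_power_eq_iff: "ratfun_q ^ i = ratfun_q ^ j \<longleftrightarrow> i = j"
proof
  assume "ratfun_q ^ i = ratfun_q ^ j"
  hence "degree ([:0, 1:] ^ i :: complex poly) = degree ([:0, 1:] ^ j :: complex poly)"
    by (simp add: ratfun_q_power)
  thus "i = j"
    by (simp add: degree_power_eq)
qed simp

lemma ratfun_q_power_eq_1_iff: "ratfun_q ^ i = 1 \<longleftrightarrow> i = 0"
  using ratfun_q_power_eq_iff[of i 0] by simp

lemma ratfun_q_nonzero: "ratfun_q \<noteq> 0"
  by (simp add: ratfun_q_def)

text \<open>Each factor is \<open>1 - q ^ (s + t * i)\<close> with \<open>q\<close> the
  indeterminate, a unit of the localization when \<open>n\<close> does not divide the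
  exponent.\<close>

lemma inverse_q_pochhammer_in_localization:
  assumes "n > 0" "\<And>i. i < k \<Longrightarrow> \<not> n dvd s + t * i"
  shows "inverse (q_pochhammer (ratfun_q ^ s) (ratfun_q ^ t) k) \<in> fract_localization (cyclotomic n)"
proof -
  have "inverse (1 - ratfun_q ^ s * (ratfun_q ^ t) ^ i) \<in> fract_localization (cyclotomic n)"
    if "i < k" for i
  proof -
    have cop: "coprime (1 - [:0, 1:] ^ (s + t * i)) (cyclotomic n)"
      using assms that by (intro coprime_cyclotomic) auto
    have eq: "1 - ratfun_q ^ s * (ratfun_q ^ t) ^ i = to_fract (1 - [:0, 1:] ^ (s + t * i))"
      by (simp only: to_fract_diff to_fract_1 ratfun_q_power[symmetric]) (simp add: power_add power_mult)
    have "s + t * i \<noteq> 0"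
      using assms(2)[OF that] by (intro notI) simp
    hence "1 - ratfun_q ^ (s + t * i) \<noteq> 0"
      using ratfun_q_power_eq_1_iff[of "s + t * i"] by auto
    hence "to_fract (1 - [:0, 1:] ^ (s + t * i) :: complex poly) \<noteq> 0"
      unfolding eq[symmetric] by (simp add: power_add power_mult)
    thus ?thesis
      unfolding eq using cop by (intro inverse_to_fract_in_localization) auto
  qed
  thus ?thesis
    unfolding q_pochhammer_def prod_inversef[symmetric] comp_def
    by (intro localization.prod_closed) auto
qed

text \<open>Each factor \<open>1 - ratfun_q ^ n\<close> is the cyclotomic polynomial times a
  polynomial \<open>g\<close>, and \<open>g\<^sup>2\<close> is absorbed into the cofactor.\<close>

lemma ratfun_congI:
  assumes "n > 1" "y \<in> fract_localization (cyclotomic n)" "A - B = (1 - ratfun_q ^ n)\<^sup>2 * y"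
  shows "ratfun_cong A B ((cyclotomic n)\<^sup>2)"
proof -
  obtain a b where y: "y = Fract a b" "b \<noteq> 0" "coprime b (cyclotomic n)"
    using assms(2) unfolding fract_localization_def by auto
  obtain g where g: "1 - [:0, 1:] ^ n = cyclotomic n * g"
    using cyclotomic_dvd[OF assms(1)] by (elim dvdE)
  have "1 - ratfun_q ^ n = to_fract (1 - [:0, 1:] ^ n)"
    by (simp only: ratfun_q_power to_fract_diff to_fract_1)
  hence "A - B = to_fract ((cyclotomic n)\<^sup>2) * (to_fract (g\<^sup>2) * y)"
    using assms(3) by (simp add: g power2_eq_square mult_ac)
  also have "to_fract (g\<^sup>2) * y = Fract (g\<^sup>2 * a) b"
    using y by (simp add: to_fract_def)
  finally show ?thesis
    unfolding ratfun_cong_def using y by auto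
qed

section \<open>The congruence\<close>

theorem theorem5:
  fixes d n :: nat
  assumes "d > 1" and "n > 1" and "[n = d + 1] (mod (2 * d))"
  shows "ratfun_cong
    (\<Sum>k=0..(n - 1) div d.
       q_integer ratfun_q (3 * d * k + 1) *
       (q_pochhammer ratfun_q (ratfun_q ^ (2 * d)) k *
        q_pochhammer (ratfun_q ^ (d - 1)) (ratfun_q ^ d) k *
        (q_pochhammer ratfun_q (ratfun_q ^ d) k)\<^sup>2 /
        (q_pochhammer (ratfun_q ^ d) (ratfun_q ^ d) k *
         q_pochhammer (ratfun_q ^ (d + 2)) (ratfun_q ^ (2 * d)) k *
         (q_pochhammer (ratfun_q ^ (2 * d)) (ratfun_q ^ (2 * d)) k)\<^sup>2)) *
       ratfun_q ^ (d * (k\<^sup>2 + k) div 2))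
    0 ((cyclotomic n)\<^sup>2)"
proof -
  define j where "j = n div (2 * d)"
  define m where "m = 2 * j + 1"
  \<comment> \<open>As \<open>d > 1\<close>, the residue \<open>d + 1\<close> is smaller than
    \<open>2 * d\<close>.\<close>
  have "n mod (2 * d) = d + 1"
    using assms(1,3) by (simp add: cong_def)
  hence "n = 2 * d * j + (d + 1)"
    unfolding j_def by (metis mult_div_mod_eq)
  hence n: "n = d * m + 1"
    by (simp add: m_def algebra_simps)
  have m: "(n - 1) div d = m"
    using assms(1) by (simp add: n)
  have d_not_dvd: "\<not> d dvd 1"
    using assms(1) by simp
  have cop: "coprime n d"
  proof (rule coprimeI)
    fix c assume "c dvd n" "c dvd d"
    thus "is_unit c"
      unfolding n using dvd_add_right_iff[of c "d * m" 1] by simp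
  qed

  define q where "q = ratfun_q"
  define p where "p = q ^ d"
  define r where "r = q ^ (d - 1)"
  define u where "u = q ^ n"
  define v where "v = inverse (q ^ n)"
  define R where "R = fract_localization (cyclotomic n)"
  interpret R: field_subring R
    unfolding R_def by (rule localization.field_subring_axioms)

  have q0: "q \<noteq> 0" and p0: "p \<noteq> 0"
    by (simp_all add: q_def p_def ratfun_q_nonzero)
  have q_eq: "q ^ i = q ^ l \<longleftrightarrow> i = l" "q ^ i = 1 \<longleftrightarrow> i = 0" for i l
    by (simp_all add: q_def ratfun_q_power_eq_iff ratfun_q_power_eq_1_iff)
  have qr: "q * r = p"
    using assms(1) by (simp add: p_def r_def flip: power_Suc)
  have p1: "p ^ i \<noteq> 1" if "i > 0" for i
    using that assms(1) by (simp add: p_def q_eq flip: power_mult)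
  have qn: "q ^ n = q * p ^ m"
    by (simp add: n p_def power_mult)
  have q_powers: "q ^ (2 * d) = p\<^sup>2" "q ^ (d + 2) = q\<^sup>2 * p"
    by (simp_all add: p_def power_add power2_eq_square mult_2)
  have inv: "inverse (q_pochhammer (q ^ s) (q ^ t) k) \<in> R" if "\<And>i. i < k \<Longrightarrow> \<not> n dvd s + t * i" for s t k
    unfolding q_def R_def using that assms(2) by (intro inverse_q_pochhammer_in_localization) auto

  \<comment> \<open>Since \<open>n\<close> is coprime to \<open>d\<close>, it would divide
    \<open>2 * Suc i\<close>, which is positive and at most \<open>d * m\<close>, hence below
    \<open>n\<close>.\<close>
  have den1: "inverse (q_pochhammer (p\<^sup>2) (p\<^sup>2) k) \<in> R" if "k \<le> m" for k
  proof -
    have "inverse (q_pochhammer (q ^ (2 * d)) (q ^ (2 * d)) k) \<in> R"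
    proof (rule inv)
      fix i assume i: "i < k"
      show "\<not> n dvd 2 * d + 2 * d * i"
      proof
        assume "n dvd 2 * d + 2 * d * i"
        hence "n dvd d * (2 * Suc i)"
          by (simp add: algebra_simps)
        hence "n dvd 2 * Suc i"
          using coprime_dvd_mult_right_iff[OF cop] by blast
        hence "n \<le> 2 * Suc i"
          by (rule dvd_imp_le) simp
        also have "\<dots> \<le> d * m"
          using i that assms(1) by (intro mult_mono) auto
        finally show False
          by (simp add: n)
      qed
    qed
    thus ?thesis
      unfolding q_powers .
  qed
  \<comment> \<open>Here the exponents are positive and below \<open>2 * n\<close>, so only
    \<open>n\<close> itself could occur; that would force \<open>d\<close> to divide
    \<open>1\<close>.\<close>
  have den2: "inverse (q_pochhammer (q\<^sup>2 * p) (p\<^sup>2) k) \<in> R" if "k \<le> m" for k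
  proof -
    have "inverse (q_pochhammer (q ^ (d + 2)) (q ^ (2 * d)) k) \<in> R"
    proof (rule inv)
      fix i assume i: "i < k"
      show "\<not> n dvd (d + 2) + 2 * d * i"
      proof
        assume "n dvd (d + 2) + 2 * d * i"
        then obtain l where l: "(d + 2) + 2 * d * i = n * l"
          by (elim dvdE)
        have "2 * d * Suc i \<le> 2 * d * m"
          using i that by (intro mult_le_mono) auto
        hence "(d + 2) + 2 * d * i < n * 2"
          using assms(1) by (simp add: n)
        hence "l < 2"
          unfolding l by simp
        moreover have "l \<noteq> 0"
          using l by (intro notI) simp
        ultimately have "(d + 2) + 2 * d * i = d * m + 1"
          using l n by (cases "l = 1") auto
        hence "d * (1 + 2 * i) + 1 = d * m"
          by (simp add: algebra_simps)
        hence "d dvd d * (1 + 2 * i) + 1"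
          by simp
        hence "d dvd 1"
          using dvd_add_right_iff[of d "d * (1 + 2 * i)" 1] by simp
        thus False
          using d_not_dvd by simp
      qed
    qed
    thus ?thesis
      unfolding q_powers .
  qed
  have den3: "inverse (q_pochhammer p p k) \<in> R" if "k \<le> m" for k
    unfolding p_def
  proof (rule inv)
    fix i assume i: "i < k"
    show "\<not> n dvd d + d * i"
    proof
      assume "n dvd d + d * i"
      hence "n dvd d * Suc i"
        by simp
      hence "n dvd Suc i"
        using coprime_dvd_mult_right_iff[OF cop] by blast
      hence "n \<le> Suc i"
        by (rule dvd_imp_le) simp
      also have "\<dots> \<le> 1 * m"
        using i that by simp
      also have "\<dots> \<le> d * m"
        using assms(1) by (intro mult_le_mono1) simp
      finally show False
        by (simp add: n)
    qed
  qed
  have inv_q: "inverse q \<in> R"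
    unfolding q_def R_def ratfun_q_def
    by (intro inverse_to_fract_in_localization coprime_X_cyclotomic) simp
  \<comment> \<open>\<open>1 - q\<close> is a Pochhammer symbol with a single factor, and
    \<open>n\<close> does not divide its exponent \<open>1\<close>.\<close>
  have inv_1_q: "inverse (1 - q) \<in> R"
    using inv[of 1 1 0] assms(2) by (simp add: q_pochhammer_def)
  have qR: "q \<in> R"
    unfolding q_def R_def ratfun_q_def by (rule to_fract_in_localization)

  have nz: "q_pochhammer (p\<^sup>2) (p\<^sup>2) m \<noteq> 0"
  proof (rule q_pochhammer_nonzero)
    show "p\<^sup>2 * (p\<^sup>2) ^ i \<noteq> 1" for i
      using p1[of "2 * Suc i"] by (simp add: power2_eq_square power_mult mult.assoc)
  qed
  have nzu: "q_pochhammer (u\<^sup>2 * p\<^sup>2) (p\<^sup>2) m \<noteq> 0"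
  proof (rule q_pochhammer_nonzero)
    fix i
    have "u\<^sup>2 * p\<^sup>2 * (p\<^sup>2) ^ i = q ^ (n * 2 + d * 2 + d * 2 * i)"
      by (simp only: u_def p_def power_add power_mult)
    thus "u\<^sup>2 * p\<^sup>2 * (p\<^sup>2) ^ i \<noteq> 1"
      using assms(2) by (simp add: q_eq)
  qed
  \<comment> \<open>A vanishing factor would make \<open>n\<close> a multiple of \<open>d\<close>,
    whereas \<open>n = d * m + 1\<close>.\<close>
  have nzv: "q_pochhammer (v\<^sup>2 * p\<^sup>2) (p\<^sup>2) m \<noteq> 0"
  proof (rule q_pochhammer_nonzero)
    fix i
    show "v\<^sup>2 * p\<^sup>2 * (p\<^sup>2) ^ i \<noteq> 1"
    proof
      assume "v\<^sup>2 * p\<^sup>2 * (p\<^sup>2) ^ i = 1"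
      hence "p\<^sup>2 * (p\<^sup>2) ^ i = (q ^ n)\<^sup>2"
        using q0 by (simp add: v_def field_simps)
      hence "q ^ (d * 2 + d * 2 * i) = q ^ (n * 2)"
        by (simp only: p_def power_add power_mult)
      hence "d * Suc i = n"
        unfolding q_eq by simp
      hence "d dvd d * m + 1"
        unfolding n[symmetric] by (metis dvd_triv_left)
      thus False
        using d_not_dvd dvd_add_right_iff[of d "d * m" 1] by simp
    qed
  qed

  have range: "{..<2 * j + 2} = {..m}"
    by (auto simp: m_def)
  \<comment> \<open>At \<open>t = u\<close> the parameter \<open>b = q / u\<close> is the inverse of
    \<open>p ^ m\<close>, because \<open>q ^ n = q * p ^ m\<close>.\<close>
  have sum_u: "(\<Sum>k\<le>m. quad_term p (u * q) (q / u) (u * r) k) = 0"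
  proof -
    have "(\<Sum>k<2 * j + 2. quad_term p (u * q) (q / u) (u * r) k) = 0"
    proof (rule quad_sum_eq_0_b[OF p0 p1])
      show "q / u * (u * r) = p"
        using q0 qr by (simp add: u_def)
      show "q / u * p ^ (2 * j + 1) = 1"
        using q0 p0 unfolding u_def qn m_def[symmetric] by simp
      show "u * q * p ^ Suc i \<noteq> p ^ (2 * j + 1)" for i
      proof -
        have "u * q * p ^ Suc i = q ^ (n + 1 + d * Suc i)" "p ^ (2 * j + 1) = q ^ (d * m)"
          by (simp_all only: u_def p_def m_def[symmetric] power_add power_mult power_one_right)
        thus ?thesis
          by (simp only: q_eq) (simp add: n)
      qed
    qed
    thus ?thesis
      unfolding range .
  qed
  \<comment> \<open>At \<open>t = v\<close> it is the parameter \<open>a = v * q\<close> that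
    becomes the inverse of \<open>p ^ m\<close>.\<close>
  have sum_v: "(\<Sum>k\<le>m. quad_term p (v * q) (q / v) (v * r) k) = 0"
  proof -
    have qv: "q / v = q ^ (d * m + 2)"
      by (simp add: v_def n field_simps)
    have "(\<Sum>k<2 * j + 2. quad_term p (v * q) (q / v) (v * r) k) = 0"
    proof (rule quad_sum_eq_0_a[OF p0 p1])
      show "q / v * (v * r) = p"
        using q0 qr by (simp add: v_def)
      show "v * q * p ^ (2 * j + 1) = 1"
        using q0 p0 unfolding v_def qn m_def[symmetric] by (simp add: field_simps)
      show "q / v * p ^ (2 * j + 1) \<noteq> p ^ (2 * (i + 1))" for i
      proof
        assume "q / v * p ^ (2 * j + 1) = p ^ (2 * (i + 1))"
        hence "q ^ (d * m + 2 + d * m) = q ^ (d * (2 * (i + 1)))"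
          unfolding qv m_def[symmetric] p_def by (simp only: power_add power_mult)
        hence "2 * (d * m + 1) = 2 * (d * (i + 1))"
          unfolding q_eq by simp
        hence "d dvd d * m + 1"
          by (metis dvd_triv_left mult_left_cancel zero_neq_numeral)
        thus False
          using d_not_dvd dvd_add_right_iff[of d "d * m" 1] by simp
      qed
      show "q / v * p ^ (2 * i + 1) \<noteq> p ^ (2 * j + 1)" for i
      proof
        assume "q / v * p ^ (2 * i + 1) = p ^ (2 * j + 1)"
        hence "q ^ (d * m + 2 + d * (2 * i + 1)) = q ^ (d * m)"
          unfolding qv m_def[symmetric] p_def by (simp only: power_add power_mult)
        thus False
          unfolding q_eq by simp
      qed
    qed
    thus ?thesis
      unfolding range .
  qed

  have "\<exists>y\<in>R. q_pochhammer (p\<^sup>2) (p\<^sup>2) m * (\<Sum>k\<le>m. quad_term p q q r k) = (1 - u) * (1 - v) * y"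
  proof (rule R.quad_sum_factor[OF _ _ _ _ _ qr _ _ _ _ nz nzu nzv sum_u sum_v])
    show "p \<in> R" "q \<in> R" "r \<in> R" "u \<in> R"
      using qR by (simp_all add: p_def r_def u_def)
    show "v \<in> R"
      using inv_q by (simp add: v_def power_inverse[symmetric])
    show "u \<noteq> 0" "v \<noteq> 0"
      using q0 by (simp_all add: u_def v_def)
    show "u \<noteq> v"
    proof
      assume "u = v"
      hence "q ^ (n + n) = 1"
        using q0 by (simp add: u_def v_def power_add field_simps)
      thus False
        using assms(2) by (simp add: q_eq)
    qed
    show "1 / (q_pochhammer (p\<^sup>2) (p\<^sup>2) k * q_pochhammer (q\<^sup>2 * p) (p\<^sup>2) k * q_pochhammer p p k) \<in> R"
      if "k \<le> m" for k
      using R.mult_closed[OF R.mult_closed[OF den1 den2] den3, OF that that that]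
      by (simp add: divide_inverse mult_ac)
  qed
  then obtain y where y: "y \<in> R"
    "q_pochhammer (p\<^sup>2) (p\<^sup>2) m * (\<Sum>k\<le>m. quad_term p q q r k) = (1 - u) * (1 - v) * y"
    by blast
  \<comment> \<open>The sign and the power of \<open>inverse q\<close> come from rewriting
    \<open>(1 - u) * (1 - v)\<close>, the inverse of \<open>1 - q\<close> from the q-integers, and
    the inverse Pochhammer symbol from the clearing factor at \<open>t = 1\<close>.\<close>
  define y' where "y' = - (inverse q ^ n * inverse (1 - q) * inverse (q_pochhammer (p\<^sup>2) (p\<^sup>2) m) * y)"
  have y'R: "y' \<in> R"
    unfolding y'_def using y(1) inv_q inv_1_q den1[of m] by auto
  have uv: "(1 - u) * (1 - v) = - ((1 - q ^ n)\<^sup>2 * inverse q ^ n)"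
    using q0 by (simp add: u_def v_def field_simps power2_eq_square)
  have sum: "(\<Sum>k\<le>m. quad_term p q q r k) * inverse (1 - q) = (1 - q ^ n)\<^sup>2 * y'"
  proof -
    have "(\<Sum>k\<le>m. quad_term p q q r k) = inverse (q_pochhammer (p\<^sup>2) (p\<^sup>2) m) * ((1 - u) * (1 - v) * y)"
      unfolding y(2)[symmetric] using nz by simp
    thus ?thesis
      unfolding uv by (simp add: y'_def mult_ac)
  qed

  \<comment> \<open>One of the two symbols \<open>(p\<^sup>2; p\<^sup>2)_k\<close> in the
    denominator is that of \<open>a * c * p\<close>, since
    \<open>q * r * p = p\<^sup>2\<close>.\<close>
  have summand: "q_integer q (3 * d * k + 1) *
       (q_pochhammer q (q ^ (2 * d)) k * q_pochhammer (q ^ (d - 1)) (q ^ d) k *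
        (q_pochhammer q (q ^ d) k)\<^sup>2 /
        (q_pochhammer (q ^ d) (q ^ d) k * q_pochhammer (q ^ (d + 2)) (q ^ (2 * d)) k *
         (q_pochhammer (q ^ (2 * d)) (q ^ (2 * d)) k)\<^sup>2)) *
       q ^ (d * (k\<^sup>2 + k) div 2) = quad_term p q q r k * inverse (1 - q)" for k
  proof -
    have e1: "q ^ (3 * d * k + 1) = q * p ^ (3 * k)"
      by (simp add: p_def mult_ac flip: power_mult)
    \<comment> \<open>\<open>k * (k + 1)\<close> is even, so \<open>d\<close> can be moved out of
      the integer division.\<close>
    have "d * (k\<^sup>2 + k) div 2 = d * (k * (k + 1) div 2)"
      by (simp add: power2_eq_square div_mult_swap add.commute)
    hence e2: "q ^ (d * (k\<^sup>2 + k) div 2) = p ^ (k * (k + 1) div 2)"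
      by (simp only: p_def power_mult)
    have e3: "q * r * p = p\<^sup>2"
      by (simp add: qr power2_eq_square)
    show ?thesis
      unfolding q_integer_def quad_term_def quad_base_def q_powers e1 e2 e3 p_def[symmetric] r_def[symmetric]
      by (simp add: divide_inverse power2_eq_square mult_ac)
  qed
  have "(\<Sum>k=0..(n - 1) div d.
       q_integer q (3 * d * k + 1) *
       (q_pochhammer q (q ^ (2 * d)) k * q_pochhammer (q ^ (d - 1)) (q ^ d) k *
        (q_pochhammer q (q ^ d) k)\<^sup>2 /
        (q_pochhammer (q ^ d) (q ^ d) k * q_pochhammer (q ^ (d + 2)) (q ^ (2 * d)) k *
         (q_pochhammer (q ^ (2 * d)) (q ^ (2 * d)) k)\<^sup>2)) *
       q ^ (d * (k\<^sup>2 + k) div 2)) - 0 = (1 - q ^ n)\<^sup>2 * y'"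
    unfolding summand m using sum by (simp add: sum_distrib_right atMost_atLeast0)
  thus ?thesis
    using y'R assms(2) unfolding q_def R_def by (intro ratfun_congI[of n y'])
qed

end
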